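(* Let $d\ge 2$, and let $h^* = \sum_{q\in\mathbb{Q}_1} w_q f_q$, $A=\{x\in[0,1]: h^*(x)=\infty\}$ and $f^* := h^*\mathbf{1}_{A^c}$ (so $f^*=h^*$ on $[0,1]\setminus A$ and $f^*=0$ on $A$) be as defined in the context. Then $f^*$ is a probability density on $[0,1]$ that is finite at every point of $[0,1]$ and satisfies $\sup_{x\in V}f^*(x)=\infty$ for every nonempty open set $V\subset[0,1]$. Moreover, the copula density $$c_{f^*}(\mathbf{u}) := f^*\Big(\Big(\sum_{j=1}^d u_j\Big)\bmod 1\Big),\qquad \mathbf{u}\in[0,1]^d,$$ of the copula $C_{f^*}$ is finite at every point of $[0,1]^d$ and satisfies $\sup_{\mathbf{u}\in U}c_{f^*}(\mathbf{u})=\infty$ for every nonempty open set $U\subset[0,1]^d$.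
   Context: For real $x$, $x\bmod 1 := x-\lfloor x\rfloor$. Let $\mathbb{Q}_1:=\mathbb{Q}\cap(0,1)$. For $q\in\mathbb{Q}_1$ and $u\in[0,1]$ define $$f_q^{\pm}(u) := \begin{cases}\dfrac{1}{2\sqrt{(\pm(u+q))\bmod 1}}, & u\ne 1-q,\\[2mm] 1/2, & u=1-q,\end{cases}\qquad f_q := \tfrac12\,(f_q^+ + f_q^-).$$ Let $(w_q)_{q\in\mathbb{Q}_1}$ be any given weights with $w_q>0$ and $\sum_{q\in\mathbb{Q}_1}w_q=1$. Define $h^*:=\sum_{q\in\mathbb{Q}_1}w_qf_q$ (with values in $[0,\infty]$), $A:=\{x\in[0,1]:h^*(x)=\infty\}$. A $d$-dimensional copula is a distribution function on $[0,1]^d$ with uniform marginals. For a probability density $f$ on $[0,1]$, $C_f$ denotes the copula with density $c_f(\mathbf{u}) := f\big((\sum_{j=1}^d u_j)\bmod 1\big)$, i.e. $C_f(\mathbf{u})=\int_{[0,u_1]\times\cdots\times[0,u_d]}c_f(\mathbf{v})\,d\mathbf{v}$. *)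

theory Defs
  imports "HOL-Probability.Probability"
begin

definition Q1 :: "real set" where
  "Q1 = \<rat> \<inter> {0<..<1}"

text \<open>
  For \<^term>\<open>u \<in> {0..1}\<close> and \<^term>\<open>q \<in> Q1\<close> the fractional parts below vanish only at
  \<^term>\<open>u = 1 - q\<close>, so no division by zero is hidden in the first branch. All functions of a
  point of the unit interval or cube are total here, but only their values there are used.
\<close>

definition f_plus :: "real \<Rightarrow> real \<Rightarrow> real" where
  "f_plus q u = (if u \<noteq> 1 - q then 1 / (2 * sqrt (frac (u + q))) else 1 / 2)"

definition f_minus :: "real \<Rightarrow> real \<Rightarrow> real" where
  "f_minus q u = (if u \<noteq> 1 - q then 1 / (2 * sqrt (frac (- (u + q)))) else 1 / 2)"

definition f_avg :: "real \<Rightarrow> real \<Rightarrow> real" where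
  "f_avg q u = (1 / 2) * (f_plus q u + f_minus q u)"

definition h_star :: "(real \<Rightarrow> real) \<Rightarrow> real \<Rightarrow> ennreal" where
  "h_star w u = (\<Sum>\<^sub>\<infinity>q\<in>Q1. ennreal (w q * f_avg q u))"

definition A_set :: "(real \<Rightarrow> real) \<Rightarrow> real set" where
  "A_set w = {x \<in> {0..1}. h_star w x = \<infinity>}"

definition f_star :: "(real \<Rightarrow> real) \<Rightarrow> real \<Rightarrow> ennreal" where
  "f_star w x = (if x \<in> A_set w then 0 else h_star w x)"

definition prob_density_on :: "'a::euclidean_space set \<Rightarrow> ('a \<Rightarrow> ennreal) \<Rightarrow> bool" where
  "prob_density_on S f \<longleftrightarrow>
     f \<in> borel_measurable (restrict_space borel S) \<and> (\<integral>\<^sup>+x\<in>S. f x \<partial>lborel) = 1"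

text \<open>
  The order on \<^typ>\<open>real ^ 'n\<close> is componentwise: \<^term>\<open>{0..1 :: real ^ 'n}\<close> is the closed unit
  cube, \<^term>\<open>{0..u :: real ^ 'n}\<close> the box with upper corner \<^term>\<open>u\<close>, and
  \<^term>\<open>{..u :: real ^ 'n}\<close> a lower orthant.
\<close>

definition is_copula :: "(real ^ 'n \<Rightarrow> real) \<Rightarrow> bool" where
  "is_copula C \<longleftrightarrow>
     (\<exists>M :: (real ^ 'n) measure. prob_space M \<and> sets M = sets borel \<and> measure M {0..1} = 1 \<and>
        (\<forall>u\<in>{0..1}. C u = measure M {..u}) \<and>
        (\<forall>i. distr M borel (\<lambda>v. v $ i) = uniform_measure lborel {0..1}))"

definition is_copula_density :: "(real ^ 'n \<Rightarrow> real) \<Rightarrow> (real ^ 'n \<Rightarrow> ennreal) \<Rightarrow> bool" where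
  "is_copula_density C c \<longleftrightarrow> prob_density_on {0..1} c \<and>
     (\<forall>u\<in>{0..1}. ennreal (C u) = (\<integral>\<^sup>+v\<in>{0..u}. c v \<partial>lborel))"

definition c_of :: "(real \<Rightarrow> ennreal) \<Rightarrow> real ^ 'n \<Rightarrow> ennreal" where
  "c_of f u = f (frac (\<Sum>j\<in>UNIV. u $ j))"

definition C_of :: "(real \<Rightarrow> ennreal) \<Rightarrow> real ^ 'n \<Rightarrow> real" where
  "C_of f u = enn2real (\<integral>\<^sup>+v\<in>{0..u}. c_of f v \<partial>lborel)"

end

theory Submission imports Defs begin

text \<open>
  Rotations and reflections of the circle \<open>\<real>/\<int>\<close> preserve Lebesgue measure, and \<open>1 / (2 * sqrt t)\<close>
  has integral \<open>1\<close> over the unit interval. Hence every \<^term>\<open>f_avg q\<close> is a probability density on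
  the unit interval, and so is the mixture \<^term>\<open>h_star w\<close>, by monotone convergence. A function
  with finite integral is finite almost everywhere, so \<^term>\<open>A_set w\<close> is a null set and
  \<^term>\<open>f_star w\<close> is a finite-valued density too (\<open>nn_integral_f_star\<close>, \<open>f_star_finite\<close>).

  Each interval inside the unit interval contains a rational point \<open>1 - q\<close>, and to the right of that
  point \<^term>\<open>h_star w\<close> is at least \<open>w q / (4 * sqrt (x - (1 - q)))\<close>. Deleting the null set
  \<^term>\<open>A_set w\<close> cannot remove a whole one-sided neighbourhood, so \<^term>\<open>f_star w\<close> stays unbounded
  (\<open>f_star_unbounded_Ioo\<close>). On the cube, moving a point along one coordinate makes the fractional
  part of the coordinate sum sweep such an interval, which transfers the unboundedness to the copula
  density (\<open>c_of_unbounded\<close>).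

  That \<^term>\<open>C_of f\<close> is a copula holds for every probability density \<open>f\<close> (\<open>copula_of_density\<close>): since
  the dimension is at least \<open>2\<close>, the density can be integrated out over a coordinate other than the
  one whose marginal is sought, and rotation invariance makes the result the constant \<open>1\<close>
  (\<open>nn_integral_c_of_cube\<close>).
\<close>

section \<open>Measure-preserving maps of the circle\<close>

lemma borel_measurable_frac [measurable]: "(frac :: real \<Rightarrow> real) \<in> borel_measurable borel"
  unfolding frac_def by measurable

lemma nn_integral_Icc_eq_Ico:
  fixes f :: "real \<Rightarrow> ennreal"
  shows "(\<integral>\<^sup>+x\<in>{a..b}. f x \<partial>lborel) = (\<integral>\<^sup>+x\<in>{a..<b}. f x \<partial>lborel)"
proof (rule nn_integral_cong_AE)
  show "AE x in lborel. f x * indicator {a..b} x = f x * indicator {a..<b} x"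
    using AE_lborel_singleton[of b] by eventually_elim (auto simp: indicator_def)
qed

text \<open>
  Split \<open>[0, 1)\<close> at the point where \<open>frac s + x\<close> passes \<open>1\<close>, and translate the two pieces.
\<close>

lemma nn_integral_frac_shift:
  fixes f :: "real \<Rightarrow> ennreal"
  assumes [measurable]: "f \<in> borel_measurable borel"
  shows "(\<integral>\<^sup>+x\<in>{0..1}. f (frac (s + x)) \<partial>lborel) = (\<integral>\<^sup>+x\<in>{0..1}. f x \<partial>lborel)"
proof -
  define r where "r = frac s"
  have r: "0 \<le> r" "r < 1" by (auto simp: r_def frac_lt_1)
  have fr: "frac (s + x) = frac (r + x)" for x
  proof -
    have "frac (r + x + of_int \<lfloor>s\<rfloor>) = frac (r + x)"
      by (simp add: frac_def)
    then show ?thesis by (simp add: r_def frac_def)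
  qed
  have "(\<integral>\<^sup>+x\<in>{0..1}. f (frac (s + x)) \<partial>lborel) = (\<integral>\<^sup>+x\<in>{0..<1}. f (frac (r + x)) \<partial>lborel)"
    by (simp add: nn_integral_Icc_eq_Ico fr)
  also have "\<dots> = (\<integral>\<^sup>+x. f (r + x) * indicator {0..<1-r} x + f (r + x - 1) * indicator {1-r..<1} x \<partial>lborel)"
  proof (rule nn_integral_cong)
    fix x
    have "frac (r + x) = r + x" if "0 \<le> x" "x < 1 - r"
      using that r by (subst frac_eq) auto
    moreover have "frac (r + x) = r + x - 1" if "1 - r \<le> x" "x < 1"
      using that r by (subst frac_unique_iff) auto
    ultimately show "f (frac (r + x)) * indicator {0..<1} x =
        f (r + x) * indicator {0..<1-r} x + f (r + x - 1) * indicator {1-r..<1} x"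
      using r by (auto simp: indicator_def)
  qed
  also have "\<dots> = (\<integral>\<^sup>+x. f (r + x) * indicator {0..<1-r} x \<partial>lborel)
      + (\<integral>\<^sup>+x. f (r + x - 1) * indicator {1-r..<1} x \<partial>lborel)"
    by (rule nn_integral_add) auto
  also have "(\<integral>\<^sup>+x. f (r + x) * indicator {0..<1-r} x \<partial>lborel) = (\<integral>\<^sup>+x. f x * indicator {r..<1} x \<partial>lborel)"
    by (subst (2) nn_integral_real_affine[where t = r and c = 1])
       (auto intro!: nn_integral_cong simp: indicator_def)
  also have "(\<integral>\<^sup>+x. f (r + x - 1) * indicator {1-r..<1} x \<partial>lborel) = (\<integral>\<^sup>+x. f x * indicator {0..<r} x \<partial>lborel)"
    by (subst (2) nn_integral_real_affine[where t = "r - 1" and c = 1])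
       (auto intro!: nn_integral_cong simp: indicator_def algebra_simps)
  also have "(\<integral>\<^sup>+x. f x * indicator {r..<1} x \<partial>lborel) + (\<integral>\<^sup>+x. f x * indicator {0..<r} x \<partial>lborel)
      = (\<integral>\<^sup>+x. f x * indicator {r..<1} x + f x * indicator {0..<r} x \<partial>lborel)"
    by (rule nn_integral_add[symmetric]) auto
  also have "\<dots> = (\<integral>\<^sup>+x\<in>{0..<1}. f x \<partial>lborel)"
    using r by (intro nn_integral_cong) (auto simp: indicator_def)
  also have "\<dots> = (\<integral>\<^sup>+x\<in>{0..1}. f x \<partial>lborel)"
    by (simp add: nn_integral_Icc_eq_Ico)
  finally show ?thesis .
qed

lemma nn_integral_frac_reflect:
  fixes f :: "real \<Rightarrow> ennreal"
  assumes [measurable]: "f \<in> borel_measurable borel"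
  shows "(\<integral>\<^sup>+x\<in>{0..1}. f (frac (s - x)) \<partial>lborel) = (\<integral>\<^sup>+x\<in>{0..1}. f x \<partial>lborel)"
proof -
  have "(\<integral>\<^sup>+x\<in>{0..1}. f (frac (s - x)) \<partial>lborel) = (\<integral>\<^sup>+x\<in>{0..1}. f (frac (s - 1 + x)) \<partial>lborel)"
    by (subst nn_integral_real_affine[where t = 1 and c = "-1"])
       (auto intro!: nn_integral_cong simp: indicator_def algebra_simps)
  then show ?thesis
    by (simp only: nn_integral_frac_shift[OF assms])
qed

section \<open>The singular densities and their mixture\<close>

lemma nn_integral_inverse_two_sqrt:
  "(\<integral>\<^sup>+x\<in>{0..1}. ennreal (1 / (2 * sqrt x)) \<partial>lborel) = 1"
proof -
  have "((\<lambda>x::real. 1 / (2 * sqrt x)) has_integral (sqrt 1 - sqrt 0)) {0..1}"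
  proof (rule fundamental_theorem_of_calculus_interior)
    fix x :: real assume "x \<in> {0<..<1}"
    then show "(sqrt has_vector_derivative 1 / (2 * sqrt x)) (at x)"
      unfolding has_real_derivative_iff_has_vector_derivative[symmetric]
      by (auto intro!: derivative_eq_intros simp: field_simps)
  qed (auto intro!: continuous_intros)
  then have "((\<lambda>x::real. 1 / (2 * sqrt x)) has_integral 1) {0..1}"
    by simp
  from nn_integral_has_integral_lebesgue[OF _ this]
  have "(\<integral>\<^sup>+x. ennreal (indicator {0..1} x * (1 / (2 * sqrt x))) \<partial>lborel) = 1"
    by simp
  moreover have "(\<integral>\<^sup>+x\<in>{0..1}. ennreal (1 / (2 * sqrt x)) \<partial>lborel)
      = (\<integral>\<^sup>+x. ennreal (indicator {0..1} x * (1 / (2 * sqrt x))) \<partial>lborel)"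
    by (intro nn_integral_cong) (simp add: indicator_def)
  ultimately show ?thesis by simp
qed

lemma borel_measurable_f_plus [measurable]: "f_plus q \<in> borel_measurable borel"
  and borel_measurable_f_minus [measurable]: "f_minus q \<in> borel_measurable borel"
  unfolding f_plus_def f_minus_def by measurable

lemma borel_measurable_f_avg [measurable]: "f_avg q \<in> borel_measurable borel"
  unfolding f_avg_def by measurable

lemma f_plus_nonneg: "f_plus q u \<ge> 0" and f_minus_nonneg: "f_minus q u \<ge> 0"
  by (auto simp: f_plus_def f_minus_def)

lemma f_avg_nonneg: "f_avg q u \<ge> 0"
  using f_plus_nonneg f_minus_nonneg by (simp add: f_avg_def)

lemma nn_integral_f_plus: "(\<integral>\<^sup>+u\<in>{0..1}. ennreal (f_plus q u) \<partial>lborel) = 1"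
proof -
  have "(\<integral>\<^sup>+u\<in>{0..1}. ennreal (f_plus q u) \<partial>lborel)
      = (\<integral>\<^sup>+u\<in>{0..1}. ennreal (1 / (2 * sqrt (frac (q + u)))) \<partial>lborel)"
    by (rule nn_integral_cong_AE, use AE_lborel_singleton[of "1 - q"] in eventually_elim)
       (simp add: f_plus_def add.commute)
  then show ?thesis
    using nn_integral_frac_shift[of "\<lambda>x. ennreal (1 / (2 * sqrt x))" q]
    by (simp add: nn_integral_inverse_two_sqrt)
qed

lemma nn_integral_f_minus: "(\<integral>\<^sup>+u\<in>{0..1}. ennreal (f_minus q u) \<partial>lborel) = 1"
proof -
  have comm: "- u - q = - q - u" for u by simp
  have "(\<integral>\<^sup>+u\<in>{0..1}. ennreal (f_minus q u) \<partial>lborel)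
      = (\<integral>\<^sup>+u\<in>{0..1}. ennreal (1 / (2 * sqrt (frac (- q - u)))) \<partial>lborel)"
    by (rule nn_integral_cong_AE, use AE_lborel_singleton[of "1 - q"] in eventually_elim)
       (simp add: f_minus_def comm)
  then show ?thesis
    using nn_integral_frac_reflect[of "\<lambda>x. ennreal (1 / (2 * sqrt x))" "- q"]
    by (simp add: nn_integral_inverse_two_sqrt)
qed

lemma nn_integral_f_avg: "(\<integral>\<^sup>+u\<in>{0..1}. ennreal (f_avg q u) \<partial>lborel) = 1"
proof -
  have avg: "ennreal (f_avg q u) = ennreal (1/2) * (ennreal (f_plus q u) + ennreal (f_minus q u))" for u
    unfolding f_avg_def
    by (subst ennreal_plus[symmetric]; (subst ennreal_mult[symmetric])?)
       (auto simp: f_plus_nonneg f_minus_nonneg)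
  have "(\<integral>\<^sup>+u\<in>{0..1}. ennreal (f_avg q u) \<partial>lborel)
      = (\<integral>\<^sup>+u. ennreal (1/2) * (ennreal (f_plus q u) * indicator {0..1} u
          + ennreal (f_minus q u) * indicator {0..1} u) \<partial>lborel)"
    unfolding avg by (intro nn_integral_cong) (auto simp: indicator_def)
  also have "\<dots> = ennreal (1/2) * (1 + 1)"
    by (simp add: nn_integral_cmult nn_integral_add nn_integral_f_plus nn_integral_f_minus)
  also have "\<dots> = ennreal (1/2) * ennreal 2" by simp
  also have "\<dots> = 1" by (subst ennreal_mult[symmetric]) auto
  finally show ?thesis .
qed

lemma countable_Q1: "countable Q1"
  unfolding Q1_def by (intro countable_Int1 countable_rat)

lemma infinite_Q1: "infinite Q1"
proof -
  have "range (\<lambda>n::nat. 1 / (real n + 2)) \<subseteq> Q1"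
    by (auto simp: Q1_def field_simps)
  moreover have "inj (\<lambda>n::nat. 1 / (real n + 2))"
    by (auto simp: inj_on_def field_simps)
  ultimately show ?thesis
    using finite_subset range_inj_infinite by blast
qed

lemma bij_betw_enum_Q1: "bij_betw (from_nat_into Q1) UNIV Q1"
  using bij_betw_from_nat_into[OF countable_Q1 infinite_Q1] .

text \<open>
  An enumeration of the rationals turns the unordered sum into a series, to which monotone
  convergence applies.
\<close>

lemma h_star_eq_suminf:
  "h_star w u = (\<Sum>n. ennreal (w (from_nat_into Q1 n) * f_avg (from_nat_into Q1 n) u))"
proof -
  let ?g = "\<lambda>n. ennreal (w (from_nat_into Q1 n) * f_avg (from_nat_into Q1 n) u)"
  have "h_star w u = infsum ?g UNIV"
    unfolding h_star_def by (rule infsum_reindex_bij_betw[OF bij_betw_enum_Q1, symmetric])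
  moreover have "?g sums infsum ?g UNIV"
    by (intro has_sum_imp_sums has_sum_infsum nonneg_summable_on_complete) auto
  ultimately show ?thesis by (simp add: sums_iff)
qed

lemma borel_measurable_h_star [measurable]: "h_star w \<in> borel_measurable borel"
  unfolding h_star_eq_suminf[abs_def] by measurable

lemma nn_integral_h_star:
  assumes "\<And>q. q \<in> Q1 \<Longrightarrow> w q > 0" and "(w has_sum 1) Q1"
  shows "(\<integral>\<^sup>+u\<in>{0..1}. h_star w u \<partial>lborel) = 1"
proof -
  let ?e = "from_nat_into Q1"
  have pos: "w (?e n) \<ge> 0" for n
    using assms(1)[of "?e n"] from_nat_into[of Q1 n] infinite_Q1 by fastforce
  have "((\<lambda>n. w (?e n)) has_sum 1) UNIV"
    using assms(2) has_sum_reindex_bij_betw[OF bij_betw_enum_Q1] by blast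
  then have sums: "(\<lambda>n. w (?e n)) sums 1" by (rule has_sum_imp_sums)
  have "(\<integral>\<^sup>+u\<in>{0..1}. h_star w u \<partial>lborel)
      = (\<integral>\<^sup>+u. (\<Sum>n. ennreal (w (?e n)) * (ennreal (f_avg (?e n) u) * indicator {0..1} u)) \<partial>lborel)"
    unfolding h_star_eq_suminf
    by (intro nn_integral_cong) (auto simp: indicator_def ennreal_mult pos f_avg_nonneg)
  also have "\<dots> = (\<Sum>n. ennreal (w (?e n)))"
    by (simp add: nn_integral_suminf nn_integral_cmult nn_integral_f_avg)
  also have "\<dots> = ennreal 1"
    using sums pos by (simp add: suminf_ennreal2 sums_iff)
  finally show ?thesis by simp
qed

lemma h_star_ge:
  assumes "q \<in> Q1"
  shows "h_star w u \<ge> ennreal (w q * f_avg q u)"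
proof -
  have "infsum (\<lambda>q. ennreal (w q * f_avg q u)) {q} \<le> h_star w u"
    unfolding h_star_def using assms
    by (intro infsum_mono_neutral nonneg_summable_on_complete) auto
  then show ?thesis by simp
qed

lemma borel_measurable_f_star [measurable]: "f_star w \<in> borel_measurable borel"
proof -
  have "A_set w = {0..1} \<inter> (h_star w -` {\<infinity>} \<inter> space borel)"
    by (auto simp: A_set_def)
  then have [measurable]: "A_set w \<in> sets borel" by simp
  show ?thesis unfolding f_star_def[abs_def] by measurable
qed

section \<open>Removing the infinite values\<close>

lemma AE_not_A_set:
  assumes "\<And>q. q \<in> Q1 \<Longrightarrow> w q > 0" and "(w has_sum 1) Q1"
  shows "AE x in lborel. x \<notin> A_set w"
proof -
  have "AE x in lborel. h_star w x * indicator {0..1} x \<noteq> \<infinity>"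
    by (rule nn_integral_PInf_AE) (use nn_integral_h_star[OF assms] in auto)
  then show ?thesis
    by eventually_elim (auto simp: A_set_def)
qed

lemma nn_integral_f_star:
  assumes "\<And>q. q \<in> Q1 \<Longrightarrow> w q > 0" and "(w has_sum 1) Q1"
  shows "(\<integral>\<^sup>+u\<in>{0..1}. f_star w u \<partial>lborel) = 1"
proof -
  have AE: "AE x in lborel. x \<notin> A_set w" by (rule AE_not_A_set[OF assms])
  have "(\<integral>\<^sup>+u\<in>{0..1}. f_star w u \<partial>lborel) = (\<integral>\<^sup>+u\<in>{0..1}. h_star w u \<partial>lborel)"
    by (rule nn_integral_cong_AE, use AE in eventually_elim) (simp add: f_star_def)
  then show ?thesis by (simp add: nn_integral_h_star[OF assms])
qed

lemma f_star_finite: "x \<in> {0..1} \<Longrightarrow> f_star w x < \<infinity>"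
  by (auto simp: f_star_def A_set_def less_top)

section \<open>Unboundedness on open sets\<close>

lemma f_avg_lower:
  assumes "0 < q" "q < 1" "1 - q < x" "x \<le> 1"
  shows "f_avg q x \<ge> 1 / (4 * sqrt (x - (1 - q)))"
proof -
  have "frac (x + q) = x - (1 - q)"
    using assms by (subst frac_unique_iff) auto
  then have "f_plus q x = 1 / (2 * sqrt (x - (1 - q)))"
    using assms by (simp add: f_plus_def)
  then show ?thesis
    using f_minus_nonneg[of q x] by (simp add: f_avg_def)
qed

lemma f_star_unbounded_Ioo:
  assumes w: "\<And>q. q \<in> Q1 \<Longrightarrow> w q > 0" "(w has_sum 1) Q1"
    and ab: "0 \<le> a" "a < b" "b \<le> 1"
  shows "(SUP x\<in>{a<..<b}. f_star w x) = \<infinity>"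
proof -
  obtain p where p: "p \<in> \<rat>" "a < p" "p < b"
    using Rats_dense_in_real[OF ab(2)] by blast
  define q where "q = 1 - p"
  have q: "q \<in> Q1" "0 < q" "q < 1"
    using p ab by (auto simp: q_def Q1_def)
  have AE: "AE x in lborel. x \<notin> A_set w" by (rule AE_not_A_set[OF w])
  have wq: "w q > 0" using w(1) q by auto
  have large: "\<exists>x\<in>{a<..<b}. ennreal K < f_star w x" if "K > 0" for K
  proof -
    \<comment> \<open>Within distance \<open>(w q / (8 * K))\<^sup>2\<close> of \<open>p\<close> the lower bound on \<open>w q * f_avg q\<close> is at least \<open>2 * K\<close>.\<close>
    define d where "d = min (b - p) ((w q / (8 * K))\<^sup>2)"
    have d: "d > 0" "d \<le> b - p" "sqrt d \<le> w q / (8 * K)"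
      using p wq that by (auto simp: d_def intro!: real_le_lsqrt)
    have "\<not> {p<..<p+d} \<subseteq> A_set w"
    proof
      assume *: "{p<..<p+d} \<subseteq> A_set w"
      have "AE x in lborel. x \<notin> {p<..<p+d}"
        using AE by eventually_elim (use * in auto)
      then have "emeasure lborel {p<..<p+d} = 0"
        by (subst (asm) AE_iff_null_sets[symmetric]) (auto dest: null_setsD1)
      with d show False by simp
    qed
    then obtain x where x: "p < x" "x < p + d" "x \<notin> A_set w"
      unfolding subset_iff greaterThanLessThan_iff by blast
    have xb: "x < b" "x \<le> 1" using x d ab by auto
    have sd: "0 < sqrt (x - p)" "sqrt (x - p) < w q / (8 * K)"
      using x d by (auto intro: less_le_trans[of _ "sqrt d"])
    have "K < w q * (1 / (4 * sqrt (x - p)))"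
      using sd that wq by (simp add: field_simps)
    also have "\<dots> \<le> w q * f_avg q x"
      using f_avg_lower[of q x] x xb q wq by (intro mult_left_mono) (auto simp: q_def)
    finally have "ennreal K < ennreal (w q * f_avg q x)"
      using that by (simp add: ennreal_less_iff)
    also have "\<dots> \<le> f_star w x"
      using h_star_ge[OF q(1)] x by (simp add: f_star_def)
    finally show ?thesis using x xb p by (intro bexI[of _ x]) auto
  qed
  have "\<exists>x\<in>{a<..<b}. y < f_star w x" if "y < \<infinity>" for y
  proof -
    have "y \<le> ennreal (enn2real y + 1)"
      using that by (cases y) (auto simp: ennreal_leI)
    then show ?thesis using large[of "enn2real y + 1"]
      by (meson add_nonneg_pos enn2real_nonneg le_less_trans zero_less_one)
  qed
  then show ?thesis
    unfolding infinity_ennreal_def SUP_eq_top_iff by auto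
qed

text \<open>
  A nonempty relatively open subset contains a ball even if all that is known about it is a boundary
  point of \<open>S\<close>: a convex set with nonempty interior lies in the closure of its interior.
\<close>

lemma openin_convex_contains_ball:
  fixes S :: "'a::euclidean_space set"
  assumes "convex S" "interior S \<noteq> {}" "openin (top_of_set S) V" "V \<noteq> {}"
  obtains x e where "e > 0" "ball x e \<subseteq> V"
proof -
  obtain T where T: "open T" "V = S \<inter> T"
    using assms(3) by (auto simp: openin_open)
  have "T \<inter> closure (interior S) \<noteq> {}"
    using T assms(4) closure_subset convex_closure_interior[OF assms(1,2)] by fastforce
  then have "T \<inter> interior S \<noteq> {}"
    using open_Int_closure_eq_empty[OF T(1)] by blast
  then obtain x where "x \<in> T \<inter> interior S" by auto
  moreover have "open (T \<inter> interior S)" using T by auto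
  ultimately obtain e where "e > 0" "ball x e \<subseteq> T \<inter> interior S"
    using open_contains_ball by blast
  with T interior_subset[of S] that show ?thesis by blast
qed

lemma f_star_unbounded:
  assumes w: "\<And>q. q \<in> Q1 \<Longrightarrow> w q > 0" "(w has_sum 1) Q1"
    and V: "openin (top_of_set {0..1}) V" "V \<noteq> {}"
  shows "(SUP x\<in>V. f_star w x) = \<infinity>"
proof -
  obtain x e where e: "e > 0" "ball x e \<subseteq> V"
    by (rule openin_convex_contains_ball[OF _ _ V]) (auto simp: interior_atLeastAtMost_real)
  have sub: "{x - e<..<x + e} \<subseteq> V" using e by (auto simp: ball_eq_greaterThanLessThan)
  have "V \<subseteq> {0..1}" using V openin_imp_subset by auto
  then have "{x - e<..<x + e} \<subseteq> {0..1}" using sub by blast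
  then have "{x - e..x + e} \<subseteq> {0..1}"
    using e closure_mono[of "{x - e<..<x + e}" "{0..1}"] by simp
  then have "0 \<le> x - e" "x + e \<le> 1" using e by auto
  then have "(SUP x\<in>{x - e<..<x + e}. f_star w x) = \<infinity>"
    using e by (intro f_star_unbounded_Ioo[OF w]) auto
  then show ?thesis
    using SUP_subset_mono[OF sub, of "f_star w" "f_star w"]
    by (metis infinity_ennreal_def order_refl top_unique)
qed

lemma sum_add_axis:
  fixes x :: "real ^ 'n::finite"
  shows "(\<Sum>j\<in>UNIV. (x + t *\<^sub>R axis k 1) $ j) = (\<Sum>j\<in>UNIV. x $ j) + t"
proof -
  have "(\<Sum>j\<in>UNIV. t * (axis k 1 :: real ^ 'n) $ j) = t"
    by (simp add: axis_def if_distrib cong: if_cong)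
  then show ?thesis by (simp add: sum.distrib)
qed

lemma c_of_unbounded:
  fixes U :: "(real ^ 'n::finite) set"
  assumes w: "\<And>q. q \<in> Q1 \<Longrightarrow> w q > 0" "(w has_sum 1) Q1"
    and U: "openin (top_of_set {0..1}) U" "U \<noteq> {}"
  shows "(SUP u\<in>U. c_of (f_star w) u) = \<infinity>"
proof -
  have box: "box 0 (1 :: real ^ 'n) \<noteq> {}"
    by (auto simp: box_ne_empty Basis_vec_def inner_axis)
  obtain x e where e: "e > 0" "ball x e \<subseteq> U"
    by (rule openin_convex_contains_ball[OF _ _ U])
       (use box in \<open>auto simp: cbox_interval[symmetric] interior_cbox\<close>)
  define s where "s = (\<Sum>j\<in>UNIV. x $ j)"
  \<comment> \<open>Any coordinate will do.\<close>
  define k :: 'n where "k = undefined"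
  \<comment> \<open>For \<open>t < 1 - frac s\<close> the fractional part of \<open>s + t\<close> is \<open>frac s + t\<close>, without wrapping around.\<close>
  define d where "d = min e (1 - frac s)"
  have d: "d > 0" "d \<le> e" "d \<le> 1 - frac s" using e frac_lt_1[of s] by (auto simp: d_def)
  have "\<exists>u\<in>U. c_of (f_star w) u = f_star w y" if y: "y \<in> {frac s<..<frac s + d}" for y
  proof
    define t where "t = y - frac s"
    have t: "0 < t" "t < d" using y by (auto simp: t_def)
    have "(\<Sum>j\<in>UNIV. (x + t *\<^sub>R axis k 1) $ j) = s + t"
      by (simp only: s_def sum_add_axis)
    moreover have "0 \<le> y" "y < 1"
      using y d frac_ge_0[of s] unfolding greaterThanLessThan_iff by linarith+
    then have "frac (s + t) = y"
      unfolding frac_unique_iff by (simp add: t_def frac_def)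
    ultimately show "c_of (f_star w) (x + t *\<^sub>R axis k 1) = f_star w y"
      by (simp only: c_of_def)
    show "x + t *\<^sub>R axis k 1 \<in> U"
      using t d e by (auto simp: dist_norm intro!: subsetD[OF e(2)])
  qed
  then have "(SUP y\<in>{frac s<..<frac s + d}. f_star w y) \<le> (SUP u\<in>U. c_of (f_star w) u)"
    by (intro SUP_mono) (metis order_refl)
  moreover have "(SUP y\<in>{frac s<..<frac s + d}. f_star w y) = \<infinity>"
    using d by (intro f_star_unbounded_Ioo[OF w]) auto
  ultimately show ?thesis by (metis infinity_ennreal_def top_unique)
qed

section \<open>Copulas from densities on the circle\<close>

text \<open>
  Fubini's theorem in one coordinate direction. Base points with vanishing \<open>b\<close>-coordinate represent
  every line parallel to \<open>b\<close>.
\<close>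

lemma nn_integral_lborel_line_cong:
  fixes F G :: "'a::euclidean_space \<Rightarrow> ennreal"
  assumes [measurable]: "F \<in> borel_measurable borel" "G \<in> borel_measurable borel"
    and b: "b \<in> Basis"
    and eq: "\<And>x. x \<bullet> b = 0 \<Longrightarrow>
      (\<integral>\<^sup>+y. F (x + y *\<^sub>R b) \<partial>lborel) = (\<integral>\<^sup>+y. G (x + y *\<^sub>R b) \<partial>lborel)"
  shows "(\<integral>\<^sup>+x. F x \<partial>lborel) = (\<integral>\<^sup>+x. G x \<partial>lborel)"
proof -
  interpret product_sigma_finite "\<lambda>_::'a. lborel :: real measure" ..
  let ?B = "Basis - {b} :: 'a set"
  let ?p = "\<lambda>x. \<Sum>c\<in>?B. x c *\<^sub>R c"
  have iter: "(\<integral>\<^sup>+x. H x \<partial>lborel)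
      = (\<integral>\<^sup>+x. (\<integral>\<^sup>+y. H (?p x + y *\<^sub>R b) \<partial>lborel) \<partial>(Pi\<^sub>M ?B (\<lambda>_. lborel)))"
    if [measurable]: "H \<in> borel_measurable borel" for H :: "'a \<Rightarrow> ennreal"
  proof -
    have split: "(\<Sum>c\<in>Basis. (x(b := y)) c *\<^sub>R c) = ?p x + y *\<^sub>R b" for x y
      by (subst sum.remove[OF _ b]) (auto simp: add.commute)
    have "(\<integral>\<^sup>+x. H x \<partial>lborel)
        = (\<integral>\<^sup>+x. H (\<Sum>c\<in>Basis. x c *\<^sub>R c) \<partial>(Pi\<^sub>M (insert b ?B) (\<lambda>_. lborel)))"
      by (subst lborel_eq, subst nn_integral_distr) (auto simp: insert_absorb b)
    also have "\<dots> = (\<integral>\<^sup>+x. (\<integral>\<^sup>+y. H (\<Sum>c\<in>Basis. (x(b := y)) c *\<^sub>R c) \<partial>lborel) \<partial>(Pi\<^sub>M ?B (\<lambda>_. lborel)))"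
      by (rule product_nn_integral_insert) (auto simp: insert_absorb b)
    finally show ?thesis by (simp only: split)
  qed
  have "?p x \<bullet> b = 0" for x
    using b by (auto simp: inner_sum_left inner_Basis intro!: sum.neutral)
  then show ?thesis
    by (simp add: iter eq)
qed

lemma borel_measurable_c_of [measurable]:
  assumes [measurable]: "f \<in> borel_measurable borel"
  shows "(c_of f :: real ^ 'n \<Rightarrow> ennreal) \<in> borel_measurable borel"
  unfolding c_of_def[abs_def] by measurable

text \<open>
  Against a function that does not depend on coordinate \<open>k\<close>, the density \<^term>\<open>c_of f\<close> integrates like
  the constant \<open>1\<close>: on each line in direction \<open>k\<close> it is a rotated copy of \<open>f\<close>.
\<close>

lemma nn_integral_c_of_cube:
  fixes H :: "real ^ 'n::finite \<Rightarrow> ennreal" and k :: 'n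
  assumes [measurable]: "f \<in> borel_measurable borel" "H \<in> borel_measurable borel"
    and f: "(\<integral>\<^sup>+x\<in>{0..1}. f x \<partial>lborel) = 1"
    and H: "\<And>x y. H (x + y *\<^sub>R axis k 1) = H x"
  shows "(\<integral>\<^sup>+v\<in>{0..1}. H v * c_of f v \<partial>lborel) = (\<integral>\<^sup>+v\<in>{0..1}. H v \<partial>lborel)"
proof (rule nn_integral_lborel_line_cong[where b = "axis k 1"])
  fix x :: "real ^ 'n" assume "x \<bullet> axis k 1 = 0"
  then have xk: "x $ k = 0" by (simp add: inner_axis)
  define s where "s = (\<Sum>j\<in>UNIV. x $ j)"
  \<comment> \<open>The line through \<open>x\<close> in direction \<open>k\<close> meets the cube iff all other coordinates lie in \<open>[0, 1]\<close>.\<close>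
  define I :: ennreal where "I = indicator {x. \<forall>j. j \<noteq> k \<longrightarrow> 0 \<le> x $ j \<and> x $ j \<le> 1} x"
  have ind: "indicator {0..1} (x + y *\<^sub>R axis k 1) = I * indicator {0..1} y" for y
    using xk by (auto simp: I_def indicator_def less_eq_vec_def axis_def)
  have c: "c_of f (x + y *\<^sub>R axis k 1) = f (frac (s + y))" for y
    by (simp only: c_of_def s_def sum_add_axis)
  have "(\<integral>\<^sup>+y. H (x + y *\<^sub>R axis k 1) * c_of f (x + y *\<^sub>R axis k 1) * indicator {0..1} (x + y *\<^sub>R axis k 1) \<partial>lborel)
      = (\<integral>\<^sup>+y. (H x * I) * (f (frac (s + y)) * indicator {0..1} y) \<partial>lborel)"
    unfolding H ind c by (simp add: mult_ac)
  also have "\<dots> = H x * I"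
    by (subst nn_integral_cmult) (auto simp: nn_integral_frac_shift f)
  also have "\<dots> = (\<integral>\<^sup>+y. (H x * I) * indicator {0..1::real} y \<partial>lborel)"
    by (subst nn_integral_cmult) auto
  also have "\<dots> = (\<integral>\<^sup>+y. H (x + y *\<^sub>R axis k 1) * indicator {0..1} (x + y *\<^sub>R axis k 1) \<partial>lborel)"
    unfolding H ind by (simp add: mult_ac)
  finally show "(\<integral>\<^sup>+y. H (x + y *\<^sub>R axis k 1) * c_of f (x + y *\<^sub>R axis k 1) * indicator {0..1} (x + y *\<^sub>R axis k 1) \<partial>lborel)
    = (\<integral>\<^sup>+y. H (x + y *\<^sub>R axis k 1) * indicator {0..1} (x + y *\<^sub>R axis k 1) \<partial>lborel)" .
qed (auto simp: axis_in_Basis_iff)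

text \<open>
  The indicator of the cube is a product over the coordinates, and only coordinate \<open>i\<close> carries the
  additional constraint \<open>B\<close>.
\<close>

lemma nn_integral_cube_coordinate:
  fixes i :: "'n::finite"
  assumes [measurable]: "B \<in> sets borel"
  shows "(\<integral>\<^sup>+v\<in>{0..1 :: real ^ 'n}. indicator B (v $ i) \<partial>lborel) = emeasure lborel ({0..1} \<inter> B)"
proof -
  let ?g = "\<lambda>b::real ^ 'n. if b = axis i 1 then indicator ({0..1} \<inter> B) else indicator {0..1} :: real \<Rightarrow> ennreal"
  have Bas: "(Basis :: (real ^ 'n) set) = range (\<lambda>j. axis j 1)"
    by (auto simp: Basis_vec_def)
  have inj: "inj (\<lambda>j::'n. axis j (1::real))" by (auto simp: inj_on_def axis_eq_axis)
  have "indicator B (v $ i) * indicator {0..1} v = (\<Prod>b\<in>Basis. ?g b (v \<bullet> b))" for v :: "real ^ 'n"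
  proof -
    have "(\<Prod>b\<in>Basis. ?g b (v \<bullet> b)) = (\<Prod>j\<in>UNIV. ?g (axis j 1) (v $ j))"
      unfolding Bas using inj by (subst prod.reindex) (auto simp: inner_axis)
    also have "\<dots> = (\<Prod>j\<in>UNIV. indicator (if j = i then {0..1} \<inter> B else {0..1}) (v $ j))"
      by (intro prod.cong) (auto simp: axis_eq_axis)
    also have "\<dots> = indicator B (v $ i) * indicator {0..1} v"
    proof (cases "v $ i \<in> B \<and> v \<in> {0..1}")
      case True
      then show ?thesis by (auto simp: less_eq_vec_def indicator_def intro!: prod.neutral)
    next
      case False
      then have "\<exists>j. v $ j \<notin> (if j = i then {0..1} \<inter> B else {0..1})"
        by (auto simp: less_eq_vec_def split: if_splits)
      then have "(\<Prod>j\<in>UNIV. indicator (if j = i then {0..1} \<inter> B else {0..1}) (v $ j)) = (0::ennreal)"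
        by (intro prod_zero) (auto simp: indicator_def split: if_splits)
      with False show ?thesis by (auto simp: indicator_def)
    qed
    finally show ?thesis by simp
  qed
  then have "(\<integral>\<^sup>+v\<in>{0..1 :: real ^ 'n}. indicator B (v $ i) \<partial>lborel)
      = (\<integral>\<^sup>+v. (\<Prod>b\<in>Basis. ?g b (v \<bullet> b)) \<partial>lborel)" by simp
  also have "\<dots> = (\<Prod>b\<in>Basis. (\<integral>\<^sup>+x. ?g b x \<partial>lborel))"
    by (rule nn_integral_lborel_prod) auto
  also have "\<dots> = (\<Prod>b\<in>(Basis :: (real ^ 'n) set). if b = axis i 1 then emeasure lborel ({0..1} \<inter> B) else 1)"
    by (intro prod.cong) auto
  also have "\<dots> = emeasure lborel ({0..1} \<inter> B)"
    by (subst prod.delta) (auto simp: axis_in_Basis_iff)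
  finally show ?thesis .
qed

lemma copula_of_density:
  fixes f :: "real \<Rightarrow> ennreal"
  assumes card: "CARD('n::finite) \<ge> 2"
    and f [measurable]: "f \<in> borel_measurable borel" "(\<integral>\<^sup>+x\<in>{0..1}. f x \<partial>lborel) = 1"
  shows "is_copula (C_of f :: real ^ 'n \<Rightarrow> real)"
    and "is_copula_density (C_of f) (c_of f :: real ^ 'n \<Rightarrow> ennreal)"
proof -
  let ?c = "c_of f :: real ^ 'n \<Rightarrow> ennreal"
  have [measurable]: "{0..u :: real ^ 'n} \<in> sets borel" for u
    unfolding cbox_interval[symmetric] by simp
  have [measurable]: "{..u :: real ^ 'n} \<in> sets borel" for u
    by (rule borel_closed) (rule closed_eucl_atMost)
  have marg: "(\<integral>\<^sup>+v\<in>{0..1}. indicator B (v $ i) * ?c v \<partial>lborel) = emeasure lborel ({0..1} \<inter> B)"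
    if [measurable]: "B \<in> sets borel" for B and i :: 'n
  proof -
    \<comment> \<open>The only use of dimension at least two: a second coordinate to integrate over.\<close>
    obtain k where k: "k \<noteq> i"
    proof -
      have "UNIV \<noteq> {i}"
        using card by (metis One_nat_def Suc_1 card.empty card.insert empty_iff finite.emptyI not_less_eq_eq order_refl)
      with that show thesis by blast
    qed
    have "(\<integral>\<^sup>+v\<in>{0..1}. indicator B (v $ i) * ?c v \<partial>lborel)
        = (\<integral>\<^sup>+v\<in>{0..1 :: real ^ 'n}. indicator B (v $ i) \<partial>lborel)"
      by (rule nn_integral_c_of_cube[where k = k]) (use f k in \<open>auto simp: axis_def\<close>)
    then show ?thesis by (simp add: nn_integral_cube_coordinate)
  qed
  have total: "(\<integral>\<^sup>+v\<in>{0..1}. ?c v \<partial>lborel) = 1"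
    using marg[of UNIV] by simp
  have fin: "(\<integral>\<^sup>+v\<in>{0..u}. ?c v \<partial>lborel) \<le> 1" if "u \<in> {0..1}" for u
  proof -
    have "(\<integral>\<^sup>+v\<in>{0..u}. ?c v \<partial>lborel) \<le> (\<integral>\<^sup>+v\<in>{0..1}. ?c v \<partial>lborel)"
      using that by (intro nn_integral_mono mult_left_mono) (auto simp: indicator_def)
    then show ?thesis by (simp add: total)
  qed
  have C: "ennreal (C_of f u) = (\<integral>\<^sup>+v\<in>{0..u}. ?c v \<partial>lborel)" if "u \<in> {0..1}" for u
    unfolding C_of_def by (rule ennreal_enn2real, rule le_less_trans[OF fin[OF that]]) simp
  show "is_copula_density (C_of f) ?c"
    using total C by (auto simp: is_copula_density_def prob_density_on_def intro: measurable_restrict_space1)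
  define M where "M = density lborel (\<lambda>v. ?c v * indicator {0..1} v)"
  have em: "emeasure M S = (\<integral>\<^sup>+v\<in>{0..1}. indicator S v * ?c v \<partial>lborel)" if "S \<in> sets borel" for S
    using that unfolding M_def by (subst emeasure_density) (auto simp: mult_ac)
  have sM [simp]: "sets M = sets borel" by (simp add: M_def)
  have spM [simp]: "space M = UNIV" by (simp add: M_def)
  have prob: "prob_space M"
    by (rule prob_spaceI) (simp add: em total)
  have "emeasure M {0..1} = (\<integral>\<^sup>+v\<in>{0..1}. ?c v \<partial>lborel)"
    by (subst em) (auto intro!: nn_integral_cong simp: indicator_def)
  then have cube: "measure M {0..1} = 1"
    by (simp add: measure_def total)
  have "emeasure M {..u} = (\<integral>\<^sup>+v\<in>{0..u}. ?c v \<partial>lborel)" if "u \<in> {0..1}" for u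
    using that by (subst em) (auto intro!: nn_integral_cong simp: indicator_def)
  then have cdf: "C_of f u = measure M {..u}" if "u \<in> {0..1}" for u
    using that by (simp add: measure_def C_of_def)
  have "distr M borel (\<lambda>v. v $ i) = uniform_measure lborel {0..1}" for i
  proof (rule measure_eqI)
    fix B assume "B \<in> sets (distr M borel (\<lambda>v. v $ i))"
    then have B [measurable]: "B \<in> sets borel" by simp
    have [measurable]: "(\<lambda>v. v $ i) \<in> measurable M borel"
      unfolding M_def by measurable
    have "emeasure (distr M borel (\<lambda>v. v $ i)) B = emeasure M ((\<lambda>v. v $ i) -` B)"
      by (subst emeasure_distr) auto
    also have "\<dots> = (\<integral>\<^sup>+v\<in>{0..1}. indicator B (v $ i) * ?c v \<partial>lborel)"
    proof (subst em)
      show "(\<lambda>v::real^'n. v $ i) -` B \<in> sets borel"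
        using measurable_sets[of "\<lambda>v::real^'n. v $ i" borel borel B] B by auto
    qed (auto intro!: nn_integral_cong simp: indicator_def)
    also have "\<dots> = emeasure (uniform_measure lborel {0..1}) B"
      by (simp add: marg divide_ennreal_def)
    finally show "emeasure (distr M borel (\<lambda>v. v $ i)) B = emeasure (uniform_measure lborel {0..1}) B" .
  qed simp
  with prob cube cdf show "is_copula (C_of f :: real ^ 'n \<Rightarrow> real)"
    unfolding is_copula_def by (intro exI[of _ M]) auto
qed

section \<open>The finite, nowhere locally bounded copula density\<close>

theorem mainTheorem3:
  fixes w :: "real \<Rightarrow> real"
  assumes "CARD('n::finite) \<ge> 2"
    and "\<And>q. q \<in> Q1 \<Longrightarrow> w q > 0"
    and "(w has_sum 1) Q1"
  shows "prob_density_on {0..1} (f_star w)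
    \<and> (\<forall>x\<in>{0..1}. f_star w x < \<infinity>)
    \<and> (\<forall>V. openin (top_of_set {0..1}) V \<and> V \<noteq> {} \<longrightarrow> (SUP x\<in>V. f_star w x) = \<infinity>)
    \<and> is_copula (C_of (f_star w) :: real ^ 'n \<Rightarrow> real)
    \<and> is_copula_density (C_of (f_star w)) (c_of (f_star w) :: real ^ 'n \<Rightarrow> ennreal)
    \<and> (\<forall>u\<in>{0..1 :: real ^ 'n}. c_of (f_star w) u < \<infinity>)
    \<and> (\<forall>U :: (real ^ 'n) set. openin (top_of_set {0..1}) U \<and> U \<noteq> {} \<longrightarrow>
          (SUP u\<in>U. c_of (f_star w) u) = \<infinity>)"
proof (intro conjI allI ballI impI)
  note w = assms(2,3)
  have int: "(\<integral>\<^sup>+x\<in>{0..1}. f_star w x \<partial>lborel) = 1"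
    by (rule nn_integral_f_star[OF w])
  then show "prob_density_on {0..1} (f_star w)"
    by (auto simp: prob_density_on_def intro: measurable_restrict_space1)
  show "is_copula (C_of (f_star w) :: real ^ 'n \<Rightarrow> real)"
    "is_copula_density (C_of (f_star w)) (c_of (f_star w) :: real ^ 'n \<Rightarrow> ennreal)"
    by (rule copula_of_density[OF assms(1) borel_measurable_f_star int])+
  show "f_star w x < \<infinity>" if "x \<in> {0..1}" for x
    by (rule f_star_finite[OF that])
  show "c_of (f_star w) u < \<infinity>" for u :: "real ^ 'n"
    unfolding c_of_def by (rule f_star_finite) (auto simp: frac_lt_1 less_imp_le)
  show "(SUP x\<in>V. f_star w x) = \<infinity>" if "openin (top_of_set {0..1}) V \<and> V \<noteq> {}" for V
    using that f_star_unbounded[OF w] by blast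
  show "(SUP u\<in>U. c_of (f_star w) u) = \<infinity>"
    if "openin (top_of_set {0..1}) U \<and> U \<noteq> {}" for U :: "(real ^ 'n) set"
    using that c_of_unbounded[OF w] by blast
qed

end
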